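(* Let $P\in\mathbb{S}^{n_x}_{++}$, $K\in\mathbb{R}^{n_u\times n_x}$ and a scalar $\gamma$ be given. The inequality $$\begin{bmatrix} P&(A+BK)P&G&0\\ P(A+BK)^\top&P&0&P(C+DK)^\top\\ G^\top&0&I&H^\top\\ 0&(C+DK)P&H&\gamma^2I\end{bmatrix}\succ0$$ holds for all $(A,B)\in\Sigma$ if there exist nonnegative scalars $\alpha_0,\alpha_1,\ldots,\alpha_{T-1}$ and a scalar $\beta>0$ such that $$\Omega-\sum_{i=0}^{T-1}\alpha_i\Psi_i\succeq0,$$ with $\Omega$ (depending on $P,K,\gamma,\beta$), $\Psi_i$ and $\Sigma$ as defined in the context.
   Context: $\mathbb{S}^{n}_{++}$ denotes the set of real symmetric positive definite $n\times n$ matrices; $\succ 0$ and $\succeq 0$ mean positive definite and positive semidefinite. Fixed known matrices: $C\in\mathbb{R}^{n_y\times n_x}$, $D\in\mathbb{R}^{n_y\times n_u}$, $G\in\mathbb{R}^{n_x\times n_d}$, $H\in\mathbb{R}^{n_y\times n_d}$. Data: a positive integer $T$, states $x_0,\ldots,x_T\in\mathbb{R}^{n_x}$ and inputs $u_0,\ldots,u_{T-1}\in\mathbb{R}^{n_u}$ are given, generated by $x_{k+1}=A_*x_k+B_*u_k+w_k$ with unknown matrices $A_*\in\mathbb{R}^{n_x\times n_x}$, $B_*\in\mathbb{R}^{n_x\times n_u}$ and unknown noise satisfying $\|w_k\|_2\le\epsilon$ for $k=0,\ldots,T-1$, for some $\epsilon>0$. For $i=0,\ldots,T-1$ define the symmetric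 matrix of size $2n_x+n_u$ $$\Psi_i=\begin{bmatrix} I & x_{i+1}\\ 0&-x_i\\ 0&-u_i\end{bmatrix}\begin{bmatrix}\epsilon^2 I&0\\ 0&-1\end{bmatrix}\begin{bmatrix} I & x_{i+1}\\ 0&-x_i\\ 0&-u_i\end{bmatrix}^\top .$$ The set of system matrices consistent with the data is $$\Sigma=\bigcap_{i=0}^{T-1}\left\{(A,B)\in\mathbb{R}^{n_x\times n_x}\times\mathbb{R}^{n_x\times n_u}\ :\ \begin{bmatrix} I\\ A^\top\\ B^\top\end{bmatrix}^\top\Psi_i\begin{bmatrix} I\\ A^\top\\ B^\top\end{bmatrix}\succeq0\right\}.$$ With $C_K=C+DK$, define $$\Omega=\begin{bmatrix}P-GG^\top-\beta I&0\\ 0&-\begin{bmatrix}I\\ K\end{bmatrix}P\begin{bmatrix}I\\ K\end{bmatrix}^\top\end{bmatrix}-\begin{bmatrix}GH^\top\\ \begin{bmatrix}I\\ K\end{bmatrix}PC_K^\top\end{bmatrix}\left(\gamma^2I-C_KPC_K^\top-HH^\top\right)^{-1}\begin{bmatrix}GH^\top\\ \begin{bmatrix}I\\ K\end{bmatrix}PC_K^\top\end{bmatrix}^\top ,$$ the inverse being understood to exist, so that $\Omega$ is defined.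
   Formalization: The matrix γ²I − C_K P C_Kᵀ − HHᵀ is assumed positive definite, not merely invertible; with mere invertibility the claim is false (e.g. scalar zero data, C=P=1, D=G=H=K=0, γ²=1/2), and its positivity is necessary for the conclusion. *)

theory Defs
  imports "HOL-Analysis.Analysis"
begin

text \<open>Block matrices are indexed by sum types: juxtaposition adds column indices,
  stacking adds row indices.  Both associate to the right, so a matrix with four block rows has
  row index type \<open>'a + ('b + ('c + 'd))\<close>.\<close>

definition hcat :: "real^'a^'m \<Rightarrow> real^'b^'m \<Rightarrow> real^('a + 'b)^'m"  (infixr \<open><|>\<close> 62) where
  "M <|> N = (\<chi> i j. case j of Inl a \<Rightarrow> M $ i $ a | Inr b \<Rightarrow> N $ i $ b)"

definition vcat :: "real^'n^'a \<Rightarrow> real^'n^'b \<Rightarrow> real^'n^('a + 'b)"  (infixr \<open><'/>\<close> 61) where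
  "M </> N = (\<chi> i. case i of Inl a \<Rightarrow> M $ a | Inr b \<Rightarrow> N $ b)"

definition pos_semidef :: "real^'n^'n \<Rightarrow> bool" where
  "pos_semidef M \<longleftrightarrow> transpose M = M \<and> (\<forall>v. 0 \<le> v \<bullet> (M *v v))"

definition pos_def :: "real^'n^'n \<Rightarrow> bool" where
  "pos_def M \<longleftrightarrow> transpose M = M \<and> (\<forall>v. v \<noteq> 0 \<longrightarrow> 0 < v \<bullet> (M *v v))"

definition data_factor :: "(nat \<Rightarrow> real^'x) \<Rightarrow> (nat \<Rightarrow> real^'u) \<Rightarrow> nat \<Rightarrow> real^('x + 1)^('x + ('x + 'u))" where
  "data_factor x u i =
     (mat 1 <|> columnvector (x (Suc i))) </>
     (0     <|> columnvector (- x i)) </>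
     (0     <|> columnvector (- u i))"

definition Psi :: "real \<Rightarrow> (nat \<Rightarrow> real^'x) \<Rightarrow> (nat \<Rightarrow> real^'u) \<Rightarrow> nat
    \<Rightarrow> real^('x + ('x + 'u))^('x + ('x + 'u))" where
  "Psi \<epsilon> x u i =
     data_factor x u i
     ** ((mat (\<epsilon>\<^sup>2) <|> 0) </> (0 <|> (- mat 1 :: real^1^1)))
     ** transpose (data_factor x u i)"

definition consistent_systems :: "nat \<Rightarrow> real \<Rightarrow> (nat \<Rightarrow> real^'x) \<Rightarrow> (nat \<Rightarrow> real^'u)
    \<Rightarrow> ((real^'x^'x) \<times> (real^'u^'x)) set" where
  "consistent_systems T \<epsilon> x u =
     (\<Inter>i\<in>{..<T}. {(A, B).
        pos_semidef (transpose (mat 1 </> transpose A </> transpose B)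
                     ** Psi \<epsilon> x u i
                     ** (mat 1 </> transpose A </> transpose B))})"

definition closed_loop_lmi :: "real^'x^'y \<Rightarrow> real^'u^'y \<Rightarrow> real^'d^'x \<Rightarrow> real^'d^'y
    \<Rightarrow> real^'x^'x \<Rightarrow> real^'x^'u \<Rightarrow> real \<Rightarrow> real^'x^'x \<Rightarrow> real^'u^'x
    \<Rightarrow> real^('x + ('x + ('d + 'y)))^('x + ('x + ('d + 'y)))" where
  "closed_loop_lmi C D G H P K \<gamma> A B =
     (P                            <|> (A + B ** K) ** P <|> G     <|> 0) </>
     (P ** transpose (A + B ** K)  <|> P                 <|> 0     <|> P ** transpose (C + D ** K)) </>
     (transpose G                  <|> 0                 <|> mat 1 <|> transpose H) </>
     (0                            <|> (C + D ** K) ** P <|> H     <|> mat (\<gamma>\<^sup>2))"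

definition Omega_pivot :: "real^'x^'y \<Rightarrow> real^'u^'y \<Rightarrow> real^'d^'y
    \<Rightarrow> real^'x^'x \<Rightarrow> real^'x^'u \<Rightarrow> real \<Rightarrow> real^'y^'y" where
  "Omega_pivot C D H P K \<gamma> =
     mat (\<gamma>\<^sup>2) - (C + D ** K) ** P ** transpose (C + D ** K) - H ** transpose H"

text \<open>\<open>matrix_inv\<close> is meaningful only when \<^const>\<open>Omega_pivot\<close> is invertible.  Invertibility
  alone does not make the Schur complement argument behind this formula valid; it needs
  \<^const>\<open>Omega_pivot\<close> to be positive definite.\<close>

definition Omega :: "real^'x^'y \<Rightarrow> real^'u^'y \<Rightarrow> real^'d^'x \<Rightarrow> real^'d^'y
    \<Rightarrow> real^'x^'x \<Rightarrow> real^'x^'u \<Rightarrow> real \<Rightarrow> real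
    \<Rightarrow> real^('x + ('x + 'u))^('x + ('x + 'u))" where
  "Omega C D G H P K \<gamma> \<beta> =
     (let J = mat 1 </> K;
          L = G ** transpose H </> J ** P ** transpose (C + D ** K)
      in ((P - G ** transpose G - mat \<beta> <|> 0) </> (0 <|> - (J ** P ** transpose J)))
         - L ** matrix_inv (Omega_pivot C D H P K \<gamma>) ** transpose L)"

end

theory Submission
  imports Defs
begin

text \<open>
  The proof compares two quadratic forms.  Write \<open>S\<close> for \<^const>\<open>Omega_pivot\<close>,
  \<open>C\<^sub>K = C + D ** K\<close>, and, for a vector \<open>a\<close> of state dimension,
  \<open>m = (A + B ** K)\<^sup>T a\<close>, \<open>g = G\<^sup>T a\<close> and \<open>l = H g + C\<^sub>K P m\<close>.

  The first form is \<^const>\<open>Omega\<close>, evaluated on the vectors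
  \<open>z = (a, A\<^sup>T a, B\<^sup>T a)\<close>.  Every matrix \<open>Psi\<close> is nonnegative on such vectors when
  \<open>(A, B)\<close> is consistent with the data, and \<^const>\<open>Omega\<close> dominates a combination
  of the \<open>Psi\<close> with nonnegative coefficients, so \<^const>\<open>Omega\<close> is nonnegative there too
  (the S-procedure).  Written out in terms of \<open>a\<close>, this is
  \<open>\<beta> |a|\<^sup>2 \<le> a \<bullet> P a - |g|\<^sup>2 - m \<bullet> P m - l \<bullet> S\<^sup>-\<^sup>1 l\<close>,
  the content of \<open>dissipation_inequality\<close>.

  The second form is the closed-loop matrix on a vector with blocks \<open>(a, b, c, d)\<close>.
  With \<open>n = C\<^sub>K\<^sup>T d\<close> and \<open>h = H\<^sup>T d\<close>, completing the squares in \<open>b\<close>, then \<open>c\<close>, then \<open>d\<close>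
  (lemmas \<open>inner_closed_loop_lmi\<close> and \<open>pos_def_complete_square\<close>) shows that the form equals
  a \<open>P\<close>-square of \<open>b + m + n\<close>, plus the squared length of \<open>c + g + h\<close>, plus an \<open>S\<close>-square of
  \<open>d - S\<^sup>-\<^sup>1 l\<close>, plus exactly the right-hand side of the inequality above.  So it is at least
  \<open>\<beta> |a|\<^sup>2\<close> plus three squares.  If the total vanishes, then \<open>a = 0\<close> because \<open>\<beta> > 0\<close>;
  hence \<open>m\<close>, \<open>g\<close> and \<open>l\<close> vanish, the \<open>S\<close>-square forces \<open>d = 0\<close>, and the other two
  squares force \<open>b = 0\<close> and \<open>c = 0\<close>.  This is the Schur complement argument carried out on
  vectors, where the strictness supplied by \<open>\<beta>\<close> is visible.
\<close>

section \<open>Block vectors and block matrices\<close>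

definition top_block :: "real^('a::finite + 'b::finite) \<Rightarrow> real^'a" where
  "top_block z = (\<chi> i. z $ Inl i)"

definition bottom_block :: "real^('a::finite + 'b::finite) \<Rightarrow> real^'b" where
  "bottom_block z = (\<chi> i. z $ Inr i)"

lemma sum_UNIV_sum_type:
  fixes f :: "'a::finite + 'b::finite \<Rightarrow> 'c::comm_monoid_add"
  shows "sum f UNIV = (\<Sum>a\<in>UNIV. f (Inl a)) + (\<Sum>b\<in>UNIV. f (Inr b))"
  by (simp add: UNIV_Plus_UNIV [symmetric] sum.Plus del: UNIV_Plus_UNIV)

lemma inner_blocks:
  "v \<bullet> w = top_block v \<bullet> top_block w + bottom_block v \<bullet> bottom_block w"
  by (simp add: inner_vec_def sum_UNIV_sum_type top_block_def bottom_block_def)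

lemma hcat_mult_vec:
  "(M <|> N) *v z = M *v top_block z + N *v bottom_block z"
  by (simp add: vec_eq_iff matrix_vector_mult_def hcat_def sum_UNIV_sum_type
      top_block_def bottom_block_def)

lemma top_block_vcat_mult_vec [simp]: "top_block ((M </> N) *v z) = M *v z"
  by (simp add: vec_eq_iff matrix_vector_mult_def vcat_def top_block_def)

lemma bottom_block_vcat_mult_vec [simp]: "bottom_block ((M </> N) *v z) = N *v z"
  by (simp add: vec_eq_iff matrix_vector_mult_def vcat_def bottom_block_def)

lemma blocks_eq_0: "top_block z = 0 \<Longrightarrow> bottom_block z = 0 \<Longrightarrow> z = 0"
  by (metis add.left_neutral inner_blocks inner_zero_left inner_eq_zero_iff)

lemma transpose_hcat: "transpose (M <|> N) = transpose M </> transpose N"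
  by (simp add: vec_eq_iff transpose_def hcat_def vcat_def split: sum.split)

lemma transpose_vcat: "transpose (M </> N) = transpose M <|> transpose N"
  by (simp add: vec_eq_iff transpose_def hcat_def vcat_def split: sum.split)

text \<open>
  Transposing a block matrix given by rows yields one given by columns; this law turns it back
  into rows, so that the symmetry of a block matrix can be read off block by block.
\<close>
lemma hcat_vcat_interchange: "(M </> N) <|> (M' </> N') = (M <|> M') </> (N <|> N')"
  by (simp add: vec_eq_iff hcat_def vcat_def split: sum.split)

section \<open>Matrix-vector products and positive definite matrices\<close>

lemma inner_matrix_mult_vec:
  fixes M :: "real^'n^'m"
  shows "v \<bullet> (M *v w) = (transpose M *v v) \<bullet> w"
  by (simp add: dot_lmul_matrix [symmetric])

lemma mat_mult_vec:
  fixes v :: "real^'n"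
  shows "mat c *v v = c *\<^sub>R v"
  by (simp add: vec_eq_iff matrix_vector_mult_def mat_def if_distrib if_distribR cong: if_cong)

lemma transpose_zero: "transpose (0 :: real^'n^'m) = 0"
  by (simp add: vec_eq_iff transpose_def)

lemma transpose_add: "transpose (M + N :: real^'n^'m) = transpose M + transpose N"
  by (simp add: vec_eq_iff transpose_def)

lemma uminus_mult_vec: "(- M) *v v = - (M *v v)" for M :: "real^'n^'m"
  by (metis diff_0 matrix_vector_mult_0 matrix_vector_mult_diff_rdistrib)

lemma sum_mult_vec: "(\<Sum>i\<in>I. M i) *v v = (\<Sum>i\<in>I. M i *v v)" for M :: "'i \<Rightarrow> real^'n^'m"
  by (induction I rule: infinite_finite_induct) (simp_all add: matrix_vector_mult_add_rdistrib)

lemma pos_def_mult_matrix_inv: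
  assumes "pos_def S"
  shows "S ** matrix_inv S = mat 1"
proof -
  have "\<forall>v. S *v v = 0 \<longrightarrow> v = 0"
    using assms unfolding pos_def_def by (metis inner_zero_right less_irrefl)
  then have "invertible S"
    by (simp add: invertible_left_inverse matrix_left_invertible_ker)
  then show ?thesis
    unfolding invertible_def matrix_inv_def by (rule someI2_ex) simp
qed

text \<open>
  Minimising \<open>d \<bullet> S d - 2 d \<bullet> l\<close> over \<open>d\<close> gives \<open>d = S\<^sup>-\<^sup>1 l\<close>; this is where the term
  \<open>L S\<^sup>-\<^sup>1 L\<^sup>T\<close> subtracted in \<^const>\<open>Omega\<close> comes from.
\<close>
lemma pos_def_complete_square:
  fixes S :: "real^'n^'n" and d l :: "real^'n"
  assumes S: "pos_def S"
  defines "e \<equiv> d - matrix_inv S *v l"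
  shows "d \<bullet> (S *v d) - 2 * (d \<bullet> l) = e \<bullet> (S *v e) - l \<bullet> (matrix_inv S *v l)"
proof -
  define f where "f = matrix_inv S *v l"
  have "S *v f = l"
    by (simp add: f_def matrix_vector_mul_assoc pos_def_mult_matrix_inv [OF S])
  moreover have "f \<bullet> (S *v d) = (S *v f) \<bullet> d"
    using S by (simp add: pos_def_def inner_matrix_mult_vec del: transpose_matrix_vector)
  ultimately show ?thesis
    by (simp add: e_def f_def [symmetric] matrix_vector_mult_diff_distrib inner_diff_left
        inner_diff_right inner_commute)
qed

lemma pos_def_nonneg: "pos_def M \<Longrightarrow> 0 \<le> v \<bullet> (M *v v)"
  by (cases "v = 0") (auto simp: pos_def_def less_imp_le)

lemma pos_def_form_eq_0: "pos_def M \<Longrightarrow> v \<bullet> (M *v v) = 0 \<Longrightarrow> v = 0"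
  by (metis less_irrefl pos_def_def)

section \<open>The inequality satisfied by every consistent system\<close>

text \<open>
  The quadratic form of \<^const>\<open>Omega\<close> depends on the lower block of \<open>z\<close> only through its image
  \<open>m\<close> under \<open>[I; K]\<^sup>T\<close>.  For \<open>z = (a, A\<^sup>T a, B\<^sup>T a)\<close> that image is \<open>(A + B ** K)\<^sup>T a\<close>,
  which is how the closed-loop matrix enters.
\<close>
lemma inner_Omega:
  fixes C :: "real^'x^'y" and D :: "real^'u^'y" and G :: "real^'d^'x" and H :: "real^'d^'y"
    and P :: "real^'x^'x" and K :: "real^'x^'u" and z :: "real^('x + ('x + 'u))"
  assumes P_sym: "transpose P = P"
  defines "a \<equiv> top_block z"
    and "m \<equiv> transpose (mat 1 </> K) *v bottom_block z"
  defines "l \<equiv> H *v (transpose G *v a) + (C + D ** K) *v (P *v m)"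
  shows "z \<bullet> (Omega C D G H P K \<gamma> \<beta> *v z) =
    a \<bullet> (P *v a) - (transpose G *v a) \<bullet> (transpose G *v a) - \<beta> * (a \<bullet> a)
    - m \<bullet> (P *v m) - l \<bullet> (matrix_inv (Omega_pivot C D H P K \<gamma>) *v l)"
proof -
  define J :: "real^'x^('x + 'u)" where "J = mat 1 </> K"
  define L where "L = G ** transpose H </> J ** P ** transpose (C + D ** K)"
  define N where "N = (P - G ** transpose G - mat \<beta> <|> 0) </> (0 <|> - (J ** P ** transpose J))"
  define R where "R = matrix_inv (Omega_pivot C D H P K \<gamma>)"
  have l: "transpose L *v z = l"
    by (simp add: L_def l_def a_def m_def J_def transpose_vcat hcat_mult_vec matrix_transpose_mul P_sym
        matrix_vector_mul_assoc [symmetric] del: transpose_matrix_vector)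
  have "z \<bullet> (L *v (R *v (transpose L *v z))) = l \<bullet> (R *v l)"
    by (simp add: inner_matrix_mult_vec [of z L] l del: transpose_matrix_vector)
  moreover have "z \<bullet> (N *v z) =
      a \<bullet> (P *v a) - (transpose G *v a) \<bullet> (transpose G *v a) - \<beta> * (a \<bullet> a) - m \<bullet> (P *v m)"
  proof -
    have "a \<bullet> (G *v (transpose G *v a)) = (transpose G *v a) \<bullet> (transpose G *v a)"
      by (rule inner_matrix_mult_vec)
    moreover have "bottom_block z \<bullet> (J *v (P *v m)) = m \<bullet> (P *v m)"
      by (simp add: m_def J_def inner_matrix_mult_vec [of "bottom_block z"] del: transpose_matrix_vector)
    ultimately show ?thesis
      by (simp add: N_def inner_blocks [of z] hcat_mult_vec a_def [symmetric]
          matrix_vector_mult_diff_rdistrib uminus_mult_vec mat_mult_vec inner_diff_right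
          matrix_vector_mul_assoc [symmetric] m_def J_def del: transpose_matrix_vector)
  qed
  moreover have "Omega C D G H P K \<gamma> \<beta> = N - L ** R ** transpose L"
    by (simp add: Omega_def Let_def N_def L_def J_def R_def)
  ultimately show ?thesis
    by (simp add: matrix_vector_mult_diff_rdistrib inner_diff_right R_def
        matrix_vector_mul_assoc [symmetric] del: transpose_matrix_vector)
qed

lemma consistent_systems_Psi_nonneg:
  assumes "(A, B) \<in> consistent_systems T \<epsilon> x u" "i < T"
    and z: "z = (mat 1 </> transpose A </> transpose B) *v v"
  shows "0 \<le> z \<bullet> (Psi \<epsilon> x u i *v z)"
proof -
  let ?Z = "mat 1 </> transpose A </> transpose B"
  have "pos_semidef (transpose ?Z ** Psi \<epsilon> x u i ** ?Z)"
    using assms by (auto simp: consistent_systems_def)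
  then have "0 \<le> v \<bullet> (transpose ?Z *v (Psi \<epsilon> x u i *v z))"
    by (simp add: pos_semidef_def z matrix_vector_mul_assoc [symmetric] del: transpose_matrix_vector)
  then show ?thesis
    by (simp add: inner_matrix_mult_vec [of v] z del: transpose_matrix_vector)
qed

text \<open>
  The S-procedure: on the vectors \<open>(a, A\<^sup>T a, B\<^sup>T a)\<close> all forms \<^const>\<open>Psi\<close> are nonnegative, hence
  so is \<^const>\<open>Omega\<close>, which dominates a nonnegative combination of them.  The block
  \<open>- \<beta> I\<close> of \<^const>\<open>Omega\<close> becomes the strictness margin on the left-hand side.
\<close>
lemma dissipation_inequality:
  fixes C :: "real^'x^'y" and D :: "real^'u^'y" and G :: "real^'d^'x" and H :: "real^'d^'y"
    and P :: "real^'x^'x" and K :: "real^'x^'u" and a :: "real^'x"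
  assumes P_sym: "transpose P = P"
    and \<alpha>: "\<And>i. i < T \<Longrightarrow> 0 \<le> \<alpha> i"
    and psd: "pos_semidef (Omega C D G H P K \<gamma> \<beta> - (\<Sum>i<T. \<alpha> i *\<^sub>R Psi \<epsilon> x u i))"
    and AB: "(A, B) \<in> consistent_systems T \<epsilon> x u"
  defines "m \<equiv> transpose (A + B ** K) *v a"
  defines "l \<equiv> H *v (transpose G *v a) + (C + D ** K) *v (P *v m)"
  shows "\<beta> * (a \<bullet> a) \<le> a \<bullet> (P *v a) - (transpose G *v a) \<bullet> (transpose G *v a)
    - m \<bullet> (P *v m) - l \<bullet> (matrix_inv (Omega_pivot C D H P K \<gamma>) *v l)"
proof -
  define z where "z = (mat 1 </> transpose A </> transpose B) *v a"
  have "0 \<le> (\<Sum>i<T. \<alpha> i * (z \<bullet> (Psi \<epsilon> x u i *v z)))"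
    using \<alpha> consistent_systems_Psi_nonneg [OF AB _ z_def]
    by (intro sum_nonneg mult_nonneg_nonneg) auto
  also have "\<dots> = z \<bullet> ((\<Sum>i<T. \<alpha> i *\<^sub>R Psi \<epsilon> x u i) *v z)"
    by (simp add: sum_mult_vec inner_sum_right scaleR_matrix_vector_assoc [symmetric])
  also have "\<dots> \<le> z \<bullet> (Omega C D G H P K \<gamma> \<beta> *v z)"
    using psd unfolding pos_semidef_def
    by (simp add: matrix_vector_mult_diff_rdistrib inner_diff_right)
  finally have "0 \<le> z \<bullet> (Omega C D G H P K \<gamma> \<beta> *v z)" .
  moreover have "top_block z = a"
    by (simp add: z_def)
  moreover have "transpose (mat 1 </> K) *v bottom_block z = m"
    by (simp add: z_def m_def transpose_vcat hcat_mult_vec transpose_add matrix_transpose_mul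
        matrix_vector_mult_add_rdistrib matrix_vector_mul_assoc [symmetric] del: transpose_matrix_vector)
  ultimately show ?thesis
    unfolding inner_Omega [OF P_sym] l_def by simp
qed

section \<open>The closed-loop matrix as a sum of squares\<close>

lemma transpose_closed_loop_lmi:
  assumes "transpose P = P"
  shows "transpose (closed_loop_lmi C D G H P K \<gamma> A B) = closed_loop_lmi C D G H P K \<gamma> A B"
  by (simp add: closed_loop_lmi_def transpose_vcat transpose_hcat hcat_vcat_interchange
      matrix_transpose_mul transpose_zero assms)

text \<open>
  The squares in \<open>b\<close> and \<open>c\<close> are completed here.  The quadratic terms in \<open>d\<close> that remain,
  \<open>\<gamma>\<^sup>2 |d|\<^sup>2 - n \<bullet> P n - |h|\<^sup>2\<close>, form exactly \<^const>\<open>Omega_pivot\<close>, and the terms mixing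
  \<open>d\<close> with \<open>a\<close> combine to \<open>- 2 d \<bullet> l\<close>.
\<close>
lemma inner_closed_loop_lmi:
  fixes C :: "real^'x^'y" and D :: "real^'u^'y" and G :: "real^'d^'x" and H :: "real^'d^'y"
    and P :: "real^'x^'x" and K :: "real^'x^'u" and A :: "real^'x^'x" and B :: "real^'u^'x"
    and v :: "real^('x + ('x + ('d + 'y)))"
  assumes P_sym: "transpose P = P"
  defines "a \<equiv> top_block v"
    and "b \<equiv> top_block (bottom_block v)"
    and "c \<equiv> top_block (bottom_block (bottom_block v))"
    and "d \<equiv> bottom_block (bottom_block (bottom_block v))"
  defines "m \<equiv> transpose (A + B ** K) *v a"
    and "n \<equiv> transpose (C + D ** K) *v d"
    and "g \<equiv> transpose G *v a"
    and "h \<equiv> transpose H *v d"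
  defines "l \<equiv> H *v g + (C + D ** K) *v (P *v m)"
  shows "v \<bullet> (closed_loop_lmi C D G H P K \<gamma> A B *v v) =
      (b + m + n) \<bullet> (P *v (b + m + n)) + (c + g + h) \<bullet> (c + g + h)
      + (a \<bullet> (P *v a) - g \<bullet> g - m \<bullet> (P *v m))
      + (d \<bullet> (Omega_pivot C D H P K \<gamma> *v d) - 2 * (d \<bullet> l))"
proof -
  have P_comm: "p \<bullet> (P *v q) = q \<bullet> (P *v p)" for p q
    by (metis P_sym inner_commute inner_matrix_mult_vec)
  have "v \<bullet> (closed_loop_lmi C D G H P K \<gamma> A B *v v) =
      a \<bullet> (P *v a) + a \<bullet> ((A + B ** K) *v (P *v b)) + a \<bullet> (G *v c)
      + (b \<bullet> (P *v m) + b \<bullet> (P *v b) + b \<bullet> (P *v n))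
      + (c \<bullet> g + c \<bullet> c + c \<bullet> h)
      + (d \<bullet> ((C + D ** K) *v (P *v b)) + d \<bullet> (H *v c) + \<gamma>\<^sup>2 * (d \<bullet> d))"
    by (simp add: closed_loop_lmi_def inner_blocks [of v] inner_blocks [of "bottom_block v"]
        inner_blocks [of "bottom_block (bottom_block v)"] hcat_mult_vec mat_mult_vec
        matrix_vector_mul_assoc [symmetric] inner_add_right
        a_def b_def c_def d_def m_def n_def g_def h_def del: transpose_matrix_vector)
  moreover have "a \<bullet> ((A + B ** K) *v (P *v b)) = m \<bullet> (P *v b)"
    "a \<bullet> (G *v c) = g \<bullet> c" "d \<bullet> (H *v c) = h \<bullet> c"
    "d \<bullet> ((C + D ** K) *v (P *v b)) = n \<bullet> (P *v b)"
    unfolding m_def n_def g_def h_def by (rule inner_matrix_mult_vec)+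
  moreover have "d \<bullet> l = h \<bullet> g + n \<bullet> (P *v m)"
    unfolding l_def n_def h_def inner_add_right
    by (simp only: inner_matrix_mult_vec [of d])
  moreover have "d \<bullet> (Omega_pivot C D H P K \<gamma> *v d) = \<gamma>\<^sup>2 * (d \<bullet> d) - n \<bullet> (P *v n) - h \<bullet> h"
    unfolding Omega_pivot_def n_def h_def
    by (simp add: matrix_vector_mult_diff_rdistrib mat_mult_vec inner_diff_right
        matrix_vector_mul_assoc [symmetric] inner_matrix_mult_vec [of d] del: transpose_matrix_vector)
  ultimately show ?thesis
    using P_comm [of b m] P_comm [of b n] P_comm [of m n]
    by (simp add: matrix_vector_right_distrib inner_add_left inner_add_right inner_commute)
qed

section \<open>Robust positive definiteness\<close>

theorem proposition2:
  fixes C :: "real^'x^'y" and D :: "real^'u^'y" and G :: "real^'d^'x" and H :: "real^'d^'y"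
    and T :: nat and x :: "nat \<Rightarrow> real^'x" and u :: "nat \<Rightarrow> real^'u"
    and A\<^sub>s :: "real^'x^'x" and B\<^sub>s :: "real^'u^'x" and w :: "nat \<Rightarrow> real^'x" and \<epsilon> :: real
    and P :: "real^'x^'x" and K :: "real^'x^'u" and \<gamma> :: real
  assumes "T > 0" and "\<epsilon> > 0"
    and "\<And>k. k < T \<Longrightarrow> x (Suc k) = A\<^sub>s *v x k + B\<^sub>s *v u k + w k"
    and "\<And>k. k < T \<Longrightarrow> norm (w k) \<le> \<epsilon>"
    and "pos_def P"
    and "pos_def (Omega_pivot C D H P K \<gamma>)"
    and "\<exists>\<alpha> \<beta>. (\<forall>i<T. 0 \<le> \<alpha> i) \<and> \<beta> > 0 \<and>
           pos_semidef (Omega C D G H P K \<gamma> \<beta> - (\<Sum>i<T. \<alpha> i *\<^sub>R Psi \<epsilon> x u i))"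
  shows "\<forall>(A, B) \<in> consistent_systems T \<epsilon> x u. pos_def (closed_loop_lmi C D G H P K \<gamma> A B)"
proof -
  obtain \<alpha> \<beta> where \<alpha>: "\<And>i. i < T \<Longrightarrow> 0 \<le> \<alpha> i" and \<beta>: "\<beta> > 0"
    and psd: "pos_semidef (Omega C D G H P K \<gamma> \<beta> - (\<Sum>i<T. \<alpha> i *\<^sub>R Psi \<epsilon> x u i))"
    using assms(7) by blast
  have P_sym: "transpose P = P"
    using assms(5) by (simp add: pos_def_def)
  have "pos_def (closed_loop_lmi C D G H P K \<gamma> A B)"
    if AB: "(A, B) \<in> consistent_systems T \<epsilon> x u" for A B
    unfolding pos_def_def
  proof (intro conjI allI impI)
    show "transpose (closed_loop_lmi C D G H P K \<gamma> A B) = closed_loop_lmi C D G H P K \<gamma> A B"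
      by (rule transpose_closed_loop_lmi [OF P_sym])
  next
    fix v :: "real^('x + ('x + ('d + 'y)))"
    assume "v \<noteq> 0"
    define a where "a = top_block v"
    define b where "b = top_block (bottom_block v)"
    define c where "c = top_block (bottom_block (bottom_block v))"
    define d where "d = bottom_block (bottom_block (bottom_block v))"
    define m where "m = transpose (A + B ** K) *v a"
    define n where "n = transpose (C + D ** K) *v d"
    define g where "g = transpose G *v a"
    define h where "h = transpose H *v d"
    define l where "l = H *v g + (C + D ** K) *v (P *v m)"
    define S where "S = Omega_pivot C D H P K \<gamma>"
    define e where "e = d - matrix_inv S *v l"
    let ?q = "v \<bullet> (closed_loop_lmi C D G H P K \<gamma> A B *v v)"
    have S: "pos_def S"
      using assms(6) by (simp add: S_def)
    have "?q = (b + m + n) \<bullet> (P *v (b + m + n)) + (c + g + h) \<bullet> (c + g + h)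
        + (a \<bullet> (P *v a) - g \<bullet> g - m \<bullet> (P *v m)) + (d \<bullet> (S *v d) - 2 * (d \<bullet> l))"
      unfolding a_def b_def c_def d_def m_def n_def g_def h_def l_def S_def
      by (rule inner_closed_loop_lmi [OF P_sym])
    also have "d \<bullet> (S *v d) - 2 * (d \<bullet> l) = e \<bullet> (S *v e) - l \<bullet> (matrix_inv S *v l)"
      unfolding e_def by (rule pos_def_complete_square [OF S])
    finally have q: "?q \<ge> (b + m + n) \<bullet> (P *v (b + m + n)) + (c + g + h) \<bullet> (c + g + h)
        + \<beta> * (a \<bullet> a) + e \<bullet> (S *v e)"
      using dissipation_inequality [OF P_sym \<alpha> psd AB, of a]
      unfolding m_def [symmetric] g_def [symmetric] l_def [symmetric] S_def [symmetric]
      by linarith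
    \<comment> \<open>All four terms of this lower bound are nonnegative, so it suffices to see that they
      cannot vanish together.\<close>
    have nonneg: "0 \<le> (b + m + n) \<bullet> (P *v (b + m + n))" "0 \<le> (c + g + h) \<bullet> (c + g + h)"
      "0 \<le> \<beta> * (a \<bullet> a)" "0 \<le> e \<bullet> (S *v e)"
      using assms(5) S \<beta> by (simp_all add: pos_def_nonneg)
    show "0 < ?q"
    proof (rule ccontr)
      assume "\<not> 0 < ?q"
      with q nonneg have zero: "(b + m + n) \<bullet> (P *v (b + m + n)) = 0"
        "(c + g + h) \<bullet> (c + g + h) = 0" "\<beta> * (a \<bullet> a) = 0" "e \<bullet> (S *v e) = 0"
        by linarith+
      have a0: "a = 0"
        using zero(3) \<beta> by simp
      then have mgl: "m = 0" "g = 0" "l = 0"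
        by (simp_all add: m_def g_def l_def)
      have d0: "d = 0"
        using pos_def_form_eq_0 [OF S zero(4)] by (simp add: e_def mgl)
      then have nh: "n = 0" "h = 0"
        by (simp_all add: n_def h_def)
      have "b = 0" "c = 0"
        using pos_def_form_eq_0 [OF assms(5) zero(1)] zero(2) by (simp_all add: mgl nh)
      with a0 d0 have "v = 0"
        unfolding a_def b_def c_def d_def by (intro blocks_eq_0)
      with \<open>v \<noteq> 0\<close> show False ..
    qed
  qed
  then show ?thesis
    by blast
qed

end
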